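(* For every integer $a \geq 3$, the position $(a,a+1,a)$ of the game Twyst-off is a $P$ position.
   Context: Twyst-off is a two-player impartial game (players alternate; normal play: the last player to move legally wins). A position is a finite ordered sequence $(s_1,\dots,s_n)$ of stacks of tiles, with stack sizes nonnegative integers. Positions are subject to the identifications: an end stack of size $0$ is deleted; an interior stack of size $0$ is deleted and its two neighbors are combined, i.e. $(\dots,x,0,y,\dots)=(\dots,x+y,\dots)$. Thus every position equals a (possibly empty) sequence of positive integers. From a sequence of positive integers, a move is one of: (i) remove $k\ge 1$ tiles from the first or from the last stack; (ii) remove the same number $k\ge 1$ of tiles from two consecutive stacks; after which the identifications are applied. A position is $P$ if the previous (second) player can force a win, equivalently if none of its options (positions reachable in one move) is $P$; it is $N$ if the next (first) player can force a win, equivalently if some option is $P$. *)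

theory Defs
  imports Main
begin

text \<open>
  A sequence of stacks is a list of natural numbers. The relation below is a single
  identification, read as a rewrite step: it erases an end stack of size 0, or erases an
  interior stack of size 0 and merges its two neighbours.
\<close>

inductive identify :: "nat list \<Rightarrow> nat list \<Rightarrow> bool" where
  first_zero: "identify (0 # xs) xs"
| last_zero: "identify (xs @ [0]) xs"
| inner_zero: "identify (xs @ [x, 0, y] @ ys) (xs @ [x + y] @ ys)"

definition reduces_to :: "nat list \<Rightarrow> nat list \<Rightarrow> bool" where
  "reduces_to p q \<longleftrightarrow> identify\<^sup>*\<^sup>* p q \<and> 0 \<notin> set q"

inductive remove_tiles :: "nat list \<Rightarrow> nat list \<Rightarrow> bool" where
  from_first: "1 \<le> k \<Longrightarrow> k \<le> x \<Longrightarrow> remove_tiles (x # xs) ((x - k) # xs)"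
| from_last: "1 \<le> k \<Longrightarrow> k \<le> x \<Longrightarrow> remove_tiles (xs @ [x]) (xs @ [x - k])"
| from_two: "1 \<le> k \<Longrightarrow> k \<le> x \<Longrightarrow> k \<le> y \<Longrightarrow>
    remove_tiles (xs @ [x, y] @ ys) (xs @ [x - k, y - k] @ ys)"

text \<open>
  Tiles are removed from the sequence of positive integers that represents the position;
  for a sequence without zeros this is the sequence itself (see \<open>reduces_to_iff\<close>).
\<close>

definition twyst_move :: "nat list \<Rightarrow> nat list \<Rightarrow> bool" where
  "twyst_move p q \<longleftrightarrow> (\<exists>p' r. reduces_to p p' \<and> remove_tiles p' r \<and> reduces_to r q)"

text \<open>
  The previous player can force a win iff every move leads to a position from which the
  next player can force a win; a player without a legal move has lost.
\<close>

inductive P_position :: "nat list \<Rightarrow> bool" and N_position :: "nat list \<Rightarrow> bool" where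
  P_positionI: "(\<And>q. twyst_move p q \<Longrightarrow> N_position q) \<Longrightarrow> P_position p"
| N_positionI: "twyst_move p q \<Longrightarrow> P_position q \<Longrightarrow> N_position p"


text \<open>Reduced forms exist and are unique: they are computed by the following function.\<close>

fun merge_zeros :: "nat list \<Rightarrow> nat list" where
  "merge_zeros [] = []"
| "merge_zeros [x] = [x]"
| "merge_zeros [x, 0] = [x]"
| "merge_zeros (x # 0 # y # ys) = merge_zeros ((x + y) # ys)"
| "merge_zeros (x # Suc y # ys) = x # merge_zeros (Suc y # ys)"

definition reduced :: "nat list \<Rightarrow> nat list" where
  "reduced p = merge_zeros (dropWhile (\<lambda>x. x = 0) p)"

lemma merge_zeros_nonzero: "0 \<notin> set xs \<Longrightarrow> merge_zeros xs = xs"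
  by (induction xs rule: merge_zeros.induct) auto

lemma merge_zeros_last: "xs \<noteq> [] \<Longrightarrow> merge_zeros (xs @ [0]) = merge_zeros xs"
  by (induction xs rule: merge_zeros.induct) auto

lemma merge_zeros_inner:
  "merge_zeros (xs @ [x, 0, y] @ ys) = merge_zeros (xs @ [x + y] @ ys)"
proof (induction xs rule: merge_zeros.induct)
  case 1
  then show ?case by simp
next
  case (2 z)
  then show ?case
    by (cases x; cases y; cases ys) auto
next
  case (3 z)
  then show ?case by (simp add: add.assoc)
next
  case (4 z w zs)
  then show ?case by simp
next
  case (5 z w zs)
  then show ?case by simp
qed

lemma merge_zeros_pos: "(case xs of [] \<Rightarrow> True | x # _ \<Rightarrow> x \<noteq> 0) \<Longrightarrow> 0 \<notin> set (merge_zeros xs)"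
  by (induction xs rule: merge_zeros.induct) auto

lemma reduced_pos: "0 \<notin> set (reduced p)"
  unfolding reduced_def
  by (rule merge_zeros_pos) (induction p, auto)

lemma reduced_nonzero: "0 \<notin> set p \<Longrightarrow> reduced p = p"
  unfolding reduced_def by (cases p) (auto simp: merge_zeros_nonzero)

lemma reduced_Cons: "reduced (x # xs) = (if x = 0 then reduced xs else merge_zeros (x # xs))"
  by (simp add: reduced_def)

lemma reduced_identify: "identify p q \<Longrightarrow> reduced p = reduced q"
proof (induction rule: identify.induct)
  case (first_zero xs)
  then show ?case by (simp add: reduced_def)
next
  case (last_zero xs)
  then show ?case
  proof (induction xs)
    case Nil
    then show ?case by (simp add: reduced_def)
  next
    case (Cons x xs)
    then show ?case
      using merge_zeros_last[of "x # xs"] by (simp add: reduced_Cons)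
  qed
next
  case (inner_zero xs x y ys)
  then show ?case
  proof (induction xs)
    case Nil
    then show ?case
      using merge_zeros_inner[of "[]" x y ys] by (simp add: reduced_Cons)
  next
    case (Cons z xs)
    then show ?case
      using merge_zeros_inner[of "z # xs" x y ys] by (simp add: reduced_Cons)
  qed
qed

lemma identify_merge_zeros: "identify\<^sup>*\<^sup>* (us @ xs) (us @ merge_zeros xs)"
proof (induction xs arbitrary: us rule: merge_zeros.induct)
  case (3 x)
  then show ?case using last_zero[of "us @ [x]"] by auto
next
  case (4 x y ys)
  then show ?case
    using inner_zero[of us x y ys] by (auto intro: converse_rtranclp_into_rtranclp)
next
  case (5 x y ys)
  then show ?case using "5"[of "us @ [x]"] by simp
qed auto

lemma identify_reduced: "identify\<^sup>*\<^sup>* p (reduced p)"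
proof (induction p)
  case Nil
  then show ?case by (simp add: reduced_def)
next
  case (Cons x p)
  then show ?case
    using identify_merge_zeros[of "[]" "x # p"]
    by (auto simp: reduced_Cons intro: converse_rtranclp_into_rtranclp first_zero)
qed

lemma reduces_to_iff: "reduces_to p q \<longleftrightarrow> q = reduced p"
proof
  assume *: "reduces_to p q"
  then have "identify\<^sup>*\<^sup>* p q" by (simp add: reduces_to_def)
  then have "reduced p = reduced q"
    by (induction rule: rtranclp_induct) (auto dest: reduced_identify)
  then show "q = reduced p"
    using * by (simp add: reduces_to_def reduced_nonzero)
next
  assume "q = reduced p"
  then show "reduces_to p q"
    by (simp add: reduces_to_def reduced_pos identify_reduced)
qed


lemma sum_list_identify: "identify p q \<Longrightarrow> sum_list q = sum_list p"
  by (induction rule: identify.induct) auto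

lemma sum_list_reduces_to: "reduces_to p q \<Longrightarrow> sum_list q = sum_list p"
proof -
  assume "reduces_to p q"
  then have "identify\<^sup>*\<^sup>* p q" by (simp add: reduces_to_def)
  then show ?thesis
    by (induction rule: rtranclp_induct) (auto dest: sum_list_identify)
qed

lemma sum_list_remove_tiles: "remove_tiles p q \<Longrightarrow> sum_list q < sum_list p"
  by (induction rule: remove_tiles.induct) auto

lemma sum_list_twyst_move: "twyst_move p q \<Longrightarrow> sum_list q < sum_list p"
  unfolding twyst_move_def
  by (metis sum_list_reduces_to sum_list_remove_tiles)

text \<open>The game is finite, so each position is exactly one of P and N.\<close>

lemma N_position_iff_not_P: "N_position p \<longleftrightarrow> \<not> P_position p"
proof (induction "sum_list p" arbitrary: p rule: less_induct)
  case less
  then have "N_position q \<longleftrightarrow> \<not> P_position q" if "twyst_move p q" for q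
    using that by (simp add: sum_list_twyst_move)
  then show ?case
    by (metis P_position.simps N_position.simps)
qed

lemma P_position_iff: "P_position p \<longleftrightarrow> (\<forall>q. twyst_move p q \<longrightarrow> \<not> P_position q)"
  by (metis P_position.simps N_position_iff_not_P)

lemma N_position_iff: "N_position p \<longleftrightarrow> (\<exists>q. twyst_move p q \<and> P_position q)"
  by (metis N_position.simps)

end

theory Submission
  imports Defs
begin

text \<open>
  Induction on \<open>a\<close>: up to reversal, every option of \<open>(a, a + 1, a)\<close> that keeps three stacks is
  \<open>(b, a + 1, a)\<close> or \<open>(b, b + 1, a)\<close> with \<open>1 \<le> b < a\<close>. For \<open>b \<ge> 3\<close> both have the smaller
  P position \<open>(b, b + 1, b)\<close> as an option; for \<open>b \<le> 2\<close> one of \<open>(1, 2)\<close> and \<open>(1, 3, 2)\<close>, or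
  the reversal of one of these, is an option. If an end stack is emptied the option is
  \<open>(a, a + 1)\<close> or \<open>(1, a)\<close>, which can both be moved to \<open>(1, 2)\<close>.
\<close>

lemma twyst_move_iff:
  \<comment> \<open>A zero-free position is its own reduced form and reduced forms are unique, so
    both reductions around the removal become explicit.\<close>
  "0 \<notin> set p \<Longrightarrow> twyst_move p q \<longleftrightarrow> (\<exists>r. remove_tiles p r \<and> q = reduced r)"
  by (auto simp: twyst_move_def reduces_to_iff reduced_nonzero)

lemma remove_tiles_two_stacks:
  assumes "remove_tiles [x, y] r"
  obtains k where "1 \<le> k" "k \<le> x" "r = [x - k, y]"
  | k where "1 \<le> k" "k \<le> y" "r = [x, y - k]"
  | k where "1 \<le> k" "k \<le> x" "k \<le> y" "r = [x - k, y - k]"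
  using assms
proof cases
  case (from_first k)
  then show ?thesis using that(1)[of k] by simp
next
  case (from_last k)
  then show ?thesis using that(2)[of k] by (auto simp: Cons_eq_append_conv)
next
  case (from_two k)
  then show ?thesis using that(3)[of k] by (auto simp: Cons_eq_append_conv)
qed

lemma remove_tiles_three_stacks:
  assumes "remove_tiles [x, y, z] r"
  obtains k where "1 \<le> k" "k \<le> x" "r = [x - k, y, z]"
  | k where "1 \<le> k" "k \<le> z" "r = [x, y, z - k]"
  | k where "1 \<le> k" "k \<le> x" "k \<le> y" "r = [x - k, y - k, z]"
  | k where "1 \<le> k" "k \<le> y" "k \<le> z" "r = [x, y - k, z - k]"
  using assms
proof cases
  case (from_first k)
  then show ?thesis using that(1)[of k] by simp
next
  case (from_last k)
  then show ?thesis using that(2)[of k] by (auto simp: Cons_eq_append_conv)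
next
  case (from_two k)
  then show ?thesis using that(3)[of k] that(4)[of k] by (auto simp: Cons_eq_append_conv)
qed

lemma N_positionI_reduced:
  "\<lbrakk>0 \<notin> set p; remove_tiles p r; P_position (reduced r)\<rbrakk> \<Longrightarrow> N_position p"
  using P_position_N_position.N_positionI twyst_move_iff by blast

lemma P_positionI_reduced:
  "\<lbrakk>0 \<notin> set p; \<And>r. remove_tiles p r \<Longrightarrow> N_position (reduced r)\<rbrakk> \<Longrightarrow> P_position p"
  by (rule P_position_N_position.P_positionI) (auto simp: twyst_move_iff)

text \<open>Fixing the surrounding lists turns the removal rules, stated with appends, into rules on
  explicit short lists.\<close>

lemmas remove_last_of_three = from_last[of _ _ "[_, _]", simplified]
lemmas remove_first_two_of_three = from_two[of _ _ _ "[]" "[_]", simplified]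
lemmas remove_last_two_of_three = from_two[of _ _ _ "[_]" "[]", simplified]
lemmas remove_last_of_two = from_last[of _ _ "[_]", simplified]
lemmas remove_both_of_two = from_two[of _ _ _ "[]" "[]", simplified]

lemma identify_rev: "identify p q \<Longrightarrow> identify (rev p) (rev q)"
proof (induction rule: identify.induct)
  case (inner_zero xs x y ys)
  then show ?case
    using identify.inner_zero[of "rev ys" y x "rev xs"] by (simp add: add.commute)
qed (simp_all add: identify.first_zero identify.last_zero)

lemma reduces_to_rev: "reduces_to p q \<Longrightarrow> reduces_to (rev p) (rev q)"
proof -
  have "identify\<^sup>*\<^sup>* p q \<Longrightarrow> identify\<^sup>*\<^sup>* (rev p) (rev q)"
  proof (induction rule: rtranclp_induct)
    case (step y z)
    then show ?case using identify_rev[of y z] by simp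
  qed simp
  then show "reduces_to p q \<Longrightarrow> reduces_to (rev p) (rev q)"
    by (simp add: reduces_to_def)
qed

lemma reduced_rev: "reduced (rev p) = rev (reduced p)"
  using reduces_to_rev[of p "reduced p"] by (simp add: reduces_to_iff)

lemma remove_tiles_rev: "remove_tiles p q \<Longrightarrow> remove_tiles (rev p) (rev q)"
proof (induction rule: remove_tiles.induct)
  case (from_two k x y xs ys)
  then show ?case
    using remove_tiles.from_two[of k y x "rev ys" "rev xs"] by simp
qed (simp_all add: remove_tiles.from_first remove_tiles.from_last)

lemma twyst_move_rev: "twyst_move p q \<Longrightarrow> twyst_move (rev p) (rev q)"
  unfolding twyst_move_def by (blast intro: reduces_to_rev remove_tiles_rev)

text \<open>Reversal is an involution that maps moves to moves, so it carries winning strategies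
  over; P and N depend on each other and need a joint induction.\<close>

lemma P_N_position_rev_imp:
  "P_position p \<Longrightarrow> P_position (rev p)" "N_position p \<Longrightarrow> N_position (rev p)"
proof (induction rule: P_position_N_position.inducts)
  case (P_positionI p)
  show ?case
  proof (rule P_position_N_position.P_positionI)
    fix q assume "twyst_move (rev p) q"
    from twyst_move_rev[OF this] have "twyst_move p (rev q)" by simp
    from P_positionI.IH[OF this] show "N_position q" by simp
  qed
next
  case (N_positionI p q)
  show ?case
    by (rule P_position_N_position.N_positionI[OF twyst_move_rev[OF N_positionI.hyps(1)]
      N_positionI.IH])
qed

lemma P_position_rev: "P_position (rev p) \<longleftrightarrow> P_position p"
  and N_position_rev: "N_position (rev p) \<longleftrightarrow> N_position p"
  using P_N_position_rev_imp[of p] P_N_position_rev_imp[of "rev p"] by auto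

lemma P_Nil: "P_position []"
  by (rule P_positionI_reduced) (auto elim: remove_tiles.cases)

lemma N_single: "1 \<le> n \<Longrightarrow> N_position [n]"
  using from_first[of n n "[]"] P_Nil
  by (intro N_positionI_reduced[of _ "[0]"]) (auto simp: reduced_def)

lemma N_equal: "1 \<le> n \<Longrightarrow> N_position [n, n]"
  using remove_both_of_two[of n n n] P_Nil
  by (intro N_positionI_reduced[of _ "[0, 0]"]) (auto simp: reduced_def)

lemma P_1_2: "P_position [1, 2]"
proof (rule P_positionI_reduced)
  fix r assume "remove_tiles [1, 2] r"
  then have "r \<in> {[0, 2], [1, 1], [1, 0], [0, 1]}"
    by (rule remove_tiles_two_stacks) auto
  then show "N_position (reduced r)"
    using N_single[of 1] N_single[of 2] N_equal[of 1] by (auto simp: reduced_def)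
qed simp

lemma P_2_1: "P_position [2, 1]"
  using P_1_2 P_position_rev[of "[1, 2]"] by simp

lemma N_1_n: "3 \<le> n \<Longrightarrow> N_position [1, n]"
  using remove_last_of_two[of "n - 2" n 1] P_1_2
  by (intro N_positionI_reduced[of _ "[1, 2]"]) (auto simp: reduced_nonzero)

lemma N_consecutive: "2 \<le> n \<Longrightarrow> N_position [n, n + 1]"
  using remove_both_of_two[of "n - 1" n "n + 1"] P_1_2
  by (intro N_positionI_reduced[of _ "[1, 2]"]) (auto simp: reduced_nonzero)

lemma N_1_2_n: "1 \<le> n \<Longrightarrow> N_position [1, 2, n]"
  using remove_last_of_three[of n n 1 2] P_1_2
  \<comment> \<open>The last equation of \<open>merge_zeros\<close> matches on \<open>Suc\<close>,
    so the numeral has to be unfolded.\<close>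
  by (intro N_positionI_reduced[of _ "[1, 2, 0]"]) (auto simp: reduced_def numeral_2_eq_2)

lemma N_1_3_1: "N_position [1, 3, 1]"
  using remove_first_two_of_three[of 1 1 3 1] P_2_1
  by (intro N_positionI_reduced[of _ "[0, 2, 1]"]) (auto simp: reduced_def numeral_2_eq_2)

lemma P_1_3_2: "P_position [1, 3, 2]"
proof (rule P_positionI_reduced)
  fix r assume "remove_tiles [1, 3, 2] r"
  \<comment> \<open>Nothing merges here: emptying the middle stack would take 3 tiles from a
    neighbor that has at most 2.\<close>
  then have "r \<in> {[0, 3, 2], [1, 3, 1], [1, 3, 0], [0, 2, 2], [1, 2, 1], [1, 1, 0]}"
    by (rule remove_tiles_three_stacks) auto
  moreover have "N_position [3, 2]"
    using N_consecutive[of 2] N_position_rev[of "[2, 3]"] by simp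
  ultimately show "N_position (reduced r)"
    using N_1_3_1 N_1_n[of 3] N_equal[of 2] N_1_2_n[of 1] N_equal[of 1]
    by (auto simp: reduced_def numeral_2_eq_2 numeral_3_eq_3)
qed simp

text \<open>Lowering the last two stacks together keeps their difference 1, so every
  \<open>[b, c + 1, c]\<close> with c < a can be reached. The winning choices are c = 2, 0, b for b
  = 1, b = 2, b \<ge> 3.\<close>

lemma N_first_lowered:
  assumes "1 \<le> b" "b < a" "3 \<le> a" and IH: "3 \<le> b \<Longrightarrow> P_position [b, b + 1, b]"
  shows "N_position [b, a + 1, a]"
proof -
  consider "b = 1" | "b = 2" | "3 \<le> b" using assms by linarith
  then show ?thesis
  proof cases
    case 1
    have "a + 1 - (a - 2) = 3" "a - (a - 2) = 2" using assms(3) by auto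
    then have "remove_tiles [1, a + 1, a] [1, 3, 2]"
      using remove_last_two_of_three[of "a - 2" "a + 1" a 1] assms(3) by simp
    with 1 show ?thesis
      using P_1_3_2 assms(3)
      by (intro N_positionI_reduced[of _ "[1, 3, 2]"]) (auto simp: reduced_nonzero)
  next
    case 2
    then show ?thesis
      using assms remove_last_two_of_three[of a "a + 1" a 2] P_2_1
      by (intro N_positionI_reduced[of _ "[2, 1, 0]"]) (auto simp: reduced_def)
  next
    case 3
    then show ?thesis
      using assms remove_last_two_of_three[of "a - b" "a + 1" a b]
      by (intro N_positionI_reduced[of _ "[b, b + 1, b]"]) (auto simp: reduced_nonzero Suc_diff_le)
  qed
qed

text \<open>Only the last stack has to be lowered: to 0, 1 or b for b = 1, b = 2 or b \<ge>
  3.\<close>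

lemma N_first_two_lowered:
  assumes "1 \<le> b" "b < a" "3 \<le> a" and IH: "3 \<le> b \<Longrightarrow> P_position [b, b + 1, b]"
  shows "N_position [b, b + 1, a]"
proof -
  consider "b = 1" | "b = 2" | "3 \<le> b" using assms by linarith
  then show ?thesis
  proof cases
    case 1
    then show ?thesis using assms N_1_2_n[of a] by (simp add: numeral_2_eq_2)
  next
    case 2
    have "P_position [2, 3, 1]"
      using P_1_3_2 P_position_rev[of "[1, 3, 2]"] by simp
    with 2 show ?thesis
      using assms remove_last_of_three[of "a - 1" a 2 3]
      by (intro N_positionI_reduced[of _ "[2, 3, 1]"]) (auto simp: reduced_nonzero)
  next
    case 3
    then show ?thesis
      using assms remove_last_of_three[of "a - b" a b "b + 1"]
      by (intro N_positionI_reduced[of _ "[b, b + 1, b]"]) (auto simp: reduced_nonzero)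
  qed
qed

theorem theorem2:
  fixes a :: nat
  assumes "a \<ge> 3"
  shows "P_position [a, a + 1, a]"
  using assms
proof (induction a rule: less_induct)
  case (less a)
  have first: "N_position (reduced [a - k, a + 1, a])" if "1 \<le> k" "k \<le> a" for k
  proof (cases "k = a")
    case True
    then show ?thesis
      using less.prems N_consecutive[of a] N_position_rev[of "[a, a + 1]"]
      by (simp add: reduced_Cons merge_zeros_nonzero)
  next
    case False
    with that have b: "1 \<le> a - k" "a - k < a" by auto
    show ?thesis
      \<comment> \<open>The induction hypothesis is still conditional on
        \<open>3 \<le> a - k\<close>, which is the form in which the lemma takes it.\<close>
      using N_first_lowered[OF b less.prems less.IH[OF b(2)]] b by (simp add: reduced_nonzero)
  qed
  have first_two: "N_position (reduced [a - k, a + 1 - k, a])" if "1 \<le> k" "k \<le> a" for k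
  proof (cases "k = a")
    case True
    then show ?thesis
      using less.prems N_1_n[of a] by (simp add: reduced_Cons merge_zeros_nonzero)
  next
    case False
    with that have b: "1 \<le> a - k" "a - k < a" by auto
    show ?thesis
      \<comment> \<open>The middle stack stays one above the lowered first one:
        \<open>a + 1 - k\<close> is \<open>(a - k) + 1\<close> because k \<le> a.\<close>
      using N_first_two_lowered[OF b less.prems less.IH[OF b(2)]] b that
      by (simp add: reduced_nonzero Suc_diff_le)
  qed
  show ?case
  proof (rule P_positionI_reduced)
    fix r assume "remove_tiles [a, a + 1, a] r"
    then show "N_position (reduced r)"
    proof (cases rule: remove_tiles_three_stacks)
      case (1 k)
      with first[of k] show ?thesis by simp
    next
      case (2 k)
      \<comment> \<open>The start position is a palindrome, so \<open>rev r\<close> results from the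
        same removal at the left end.\<close>
      with first[of k] have "N_position (reduced (rev r))" by simp
      then show ?thesis by (simp only: reduced_rev N_position_rev)
    next
      case (3 k)
      with first_two[of k] show ?thesis by simp
    next
      case (4 k)
      with first_two[of k] have "N_position (reduced (rev r))" by simp
      then show ?thesis by (simp only: reduced_rev N_position_rev)
    qed
  qed (use less.prems in auto)
qed

end
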